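(* For all integers $k\ge 3$, it holds that $g(2,k)=\frac{k(k+1)}{2}$.
   Context: A state with $k$ vessels is a vector $A=(a_1,\dots,a_k)$ of non-negative integers (the contents of the vessels). A pouring step chooses two distinct vessels with contents $x$ and $y$, where $x\le y$, and replaces these contents by $2x$ (for the vessel that contained $x$) and $y-x$ (for the vessel that contained $y$); all other contents are unchanged. For an integer $p\ge 0$, a state is $p$-pourable if some sequence of at most $p$ pouring steps leads to a state in which at least one vessel has content $0$. For positive integers $N$ and $k\ge 3$, $g(N,k)$ is the smallest positive integer $n$ such that some state $A=(a_1,\dots,a_k)$ with $a_1+\cdots+a_k=n$ is not $(N-1)$-pourable. *)

theory Defs
  imports Main
begin

type_synonym state = "nat list"

definition pour_step :: "state \<Rightarrow> state \<Rightarrow> bool" where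
  "pour_step A B \<longleftrightarrow>
     (\<exists>i j. i < length A \<and> j < length A \<and> i \<noteq> j \<and> A ! i \<le> A ! j \<and>
            B = A[i := 2 * (A ! i), j := A ! j - A ! i])"

definition pourable :: "nat \<Rightarrow> state \<Rightarrow> bool" where
  "pourable p A \<longleftrightarrow> (\<exists>m\<le>p. \<exists>B. (pour_step ^^ m) A B \<and> 0 \<in> set B)"

(* Only meaningful for N > 0, where the truncated subtraction N - 1 is exact, and k >= 3. *)
definition g :: "nat \<Rightarrow> nat \<Rightarrow> nat" where
  "g N k = (LEAST n. 0 < n \<and>
     (\<exists>A. length A = k \<and> sum_list A = n \<and> \<not> pourable (N - 1) A))"

end

theory Submission
  imports Defs
begin

text \<open>For \<open>N = 2\<close> a single pour is allowed. It creates an empty vessel only if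
  the two contents are equal, unless a vessel was empty already. So the states that are not
  1-pourable are exactly those with distinct positive contents (\<open>pourable_Suc_0_iff\<close>),
  and k distinct positive integers sum to at least 1 + ... + k
  (\<open>sum_atLeast_Suc_0_card_le\<close>), with equality for 1, ..., k.\<close>

lemma pourable_Suc_0_iff:
  "pourable (Suc 0) A \<longleftrightarrow> 0 \<in> set A \<or> \<not> distinct A"
proof
  assume "pourable (Suc 0) A"
  then obtain m B where m: "m \<le> Suc 0" and B: "(pour_step ^^ m) A B" "0 \<in> set B"
    unfolding pourable_def by blast
  show "0 \<in> set A \<or> \<not> distinct A"
  proof (cases "m = 0")
    case True
    with B show ?thesis by simp
  next
    case False
    with m B have "pour_step A B" by (simp add: le_Suc_eq OO_def)
    then obtain i j where ij: "i < length A" "j < length A" "i \<noteq> j" "A ! i \<le> A ! j"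
      and B': "B = A[i := 2 * (A ! i), j := A ! j - A ! i]"
      unfolding pour_step_def by blast
    \<comment> \<open>A zero in \<open>B\<close> is an old entry, a doubled one, or the difference.
      Truncated subtraction does no harm: with \<open>A ! i \<le> A ! j\<close>, a zero difference
      forces equal contents at \<open>i \<noteq> j\<close>.\<close>
    have "0 \<in> insert (A ! j - A ! i) (insert (2 * (A ! i)) (set A))"
      using B(2) set_update_subset_insert[of "A[i := 2 * (A ! i)]" j "A ! j - A ! i"]
        set_update_subset_insert[of A i "2 * (A ! i)"] unfolding B' by blast
    then show ?thesis
      using ij by (auto simp: distinct_conv_nth in_set_conv_nth)
  qed
next
  assume "0 \<in> set A \<or> \<not> distinct A"
  then show "pourable (Suc 0) A"
  proof
    assume "0 \<in> set A"
    then show ?thesis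
      unfolding pourable_def by (intro exI[of _ 0]) auto
  next
    assume "\<not> distinct A"
    then obtain i j where ij: "i < length A" "j < length A" "i \<noteq> j" "A ! i = A ! j"
      by (auto simp: distinct_conv_nth)
    let ?B = "A[i := 2 * (A ! i), j := A ! j - A ! i]"
    have "pour_step A ?B"
      unfolding pour_step_def using ij by (intro exI[of _ i] exI[of _ j]) simp
    then have "(pour_step ^^ Suc 0) A ?B"
      by (simp add: OO_def)
    moreover have "0 \<in> set ?B"
      using ij set_update_memI[of j "A[i := 2 * (A ! i)]" 0] by simp
    ultimately show ?thesis
      unfolding pourable_def by blast
  qed
qed

text \<open>Induction that adds the elements in increasing order: each new maximum is at least the
  new cardinality, which is the term gained on the left.\<close>

lemma sum_atLeast_Suc_0_card_le:
  fixes S :: "nat set"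
  assumes "finite S" and "0 \<notin> S"
  shows "\<Sum>{1..card S} \<le> \<Sum>S"
  using assms
proof (induction S rule: finite_linorder_max_induct)
  case empty
  then show ?case by simp
next
  case (insert b S)
  \<comment> \<open>Positivity and the maximality of \<open>b\<close> confine the set to
    \<open>b\<close> possible values.\<close>
  have "insert b S \<subseteq> {1..b}"
    using insert.hyps insert.prems by (auto simp: Suc_le_eq less_imp_le intro: gr0I)
  then have "card (insert b S) \<le> b"
    using card_mono[of "{1..b}"] by fastforce
  moreover have "b \<notin> S"
    using insert.hyps by blast
  ultimately show ?case
    using insert by simp
qed

theorem theorem23:
  fixes k :: nat
  assumes "k \<ge> 3"
  shows "g 2 k = k * (k + 1) div 2"
proof -
  let ?P = "\<lambda>n. 0 < n \<and> (\<exists>A. length A = k \<and> sum_list A = n \<and> \<not> pourable (2 - 1) A)"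
  have gauss: "\<Sum>{1..k} = k * (k + 1) div 2"
    using gauss_sum_from_Suc_0[of k, where 'a = nat] by simp
  have "(LEAST n. ?P n) = k * (k + 1) div 2"
  proof (rule Least_equality)
    have "\<not> pourable (Suc 0) [1..<Suc k]"
      by (simp add: pourable_Suc_0_iff)
    moreover have "sum_list [1..<Suc k] = k * (k + 1) div 2"
      using gauss by (simp only: sum_list_distinct_conv_sum_set[of _ id, simplified]
        distinct_upt set_upt atLeastLessThanSuc_atLeastAtMost)
    moreover have "0 < k * (k + 1) div 2"
      using assms by (simp add: div_greater_zero_iff)
    ultimately show "?P (k * (k + 1) div 2)"
      by (intro conjI exI[of _ "[1..<Suc k]"]) auto
  next
    fix n
    assume "?P n"
    then obtain A where A: "length A = k" "sum_list A = n" "0 \<notin> set A" "distinct A"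
      by (auto simp: pourable_Suc_0_iff)
    \<comment> \<open>Distinctness lets the list be replaced by its set: the cardinality is
      \<open>k\<close> and the sum is \<open>n\<close>.\<close>
    have "\<Sum>{1..card (set A)} \<le> \<Sum>(set A)"
      using A by (intro sum_atLeast_Suc_0_card_le) auto
    then show "k * (k + 1) div 2 \<le> n"
      using A gauss by (simp add: distinct_card distinct_sum_list_conv_Sum)
  qed
  then show ?thesis
    by (simp only: g_def)
qed

end
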